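(* Let $J_0>1$ and $\mu>0$, and consider the two-dimensional compressible Hadamard material with stored energy $W(\boldsymbol F)=\frac{\mu}{2}\operatorname{tr}(\boldsymbol F^\top\boldsymbol F)+h(\det\boldsymbol F)$, $h(J)=\frac{1}{4J_0}\big((J_0-J)^2-1\big)^2$, and the static phase boundary $(\underline{\boldsymbol F}^{\pm},\boldsymbol 0,0,\hat{\boldsymbol e}_1)$ described in the context, with kinetic rule given by the Maxwell rule ($\tilde g\equiv 0$). Set $$\delta_1:=1-\frac{4}{27J_0^2\mu^2}-\frac{4}{9\mu^2},\qquad \mu_*:=\frac23\sqrt{1+\frac{1}{3J_0^2}}.$$ (i) If $0<\mu<\mu_*$, then $\delta_1<0$ and the phase boundary is strongly unstable. (ii) If $\mu\ge\mu_*$, then $\delta_1\ge 0$ and the phase boundary is weakly stable.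
   Context: Material. For $\boldsymbol F\in\mathbb R^{2\times2}$ with $\det\boldsymbol F>0$ let $\boldsymbol\sigma(\boldsymbol F)=\partial W/\partial\boldsymbol F$; $\boldsymbol F_j$, $\boldsymbol\sigma(\boldsymbol F)_j$ denote $j$-th columns, and $\boldsymbol B_i^j(\boldsymbol F)=\partial\boldsymbol\sigma_j/\partial\boldsymbol F_i\in\mathbb R^{2\times2}$, with $(k,l)$ entry $\partial^2W/\partial F_{kj}\partial F_{li}$. $\hat{\boldsymbol e}_1,\hat{\boldsymbol e}_2$ is the canonical basis of $\mathbb R^2$ and $\mathbf I_2$ the identity. Phase boundary. With $\theta_0=\frac{3\mu J_0}{2}$, put $\underline{\boldsymbol F}^{\pm}=\operatorname{diag}\big((J_0\pm\frac1{\sqrt3})\frac{1}{\sqrt{\theta_0}},\ \sqrt{\theta_0}\big)$. The phase boundary $(\underline{\boldsymbol F}^{\pm},\boldsymbol 0,0,\hat{\boldsymbol e}_1)$ is the static weak solution $(\boldsymbol F,\boldsymbol v)=(\underline{\boldsymbol F}^-,\boldsymbol0)$ for $x_1<0$, $(\underline{\boldsymbol F}^+,\boldsymbol0)$ for $x_1>0$, of the elastodynamics system $\boldsymbol F_t-\nabla_x\boldsymbol v=0$, $\boldsymbol v_t-\operatorname{div}_x\boldsymbol\sigma(\boldsymbol F)=0$, $\operatorname{curl}_x\boldsymbol F=0$ in $\mathbb R^2$ (speed $s=0$, normal $\boldsymbol n=\hat{\boldsymbol e}_1$). Write $[\![a]\!]=a^+-a^-$ and $\langle a\rangle=\frac12(a^++a^-)$.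 Kinetic rule. This is an extra jump condition $g\big((\boldsymbol F^-,\boldsymbol v^-),(\boldsymbol F^+,\boldsymbol v^+),s,\boldsymbol n\big)=0$ with $g=[\![W]\!]-\boldsymbol n^\top[\![\boldsymbol F]\!]^\top\langle\boldsymbol\sigma(\boldsymbol F)\rangle\boldsymbol n+\tilde g$. The Maxwell rule is $\tilde g\equiv0$. Lopatinskiĭ determinant. Let $\Gamma=\{(\lambda,\xi)\in\mathbb C\times\mathbb R:\ |\lambda|^2+|\xi|^2=1,\ \operatorname{Re}\lambda\ge0\}$ and $\Gamma^+=\Gamma\cap\{\operatorname{Re}\lambda>0\}$. With superscripts $\pm$ denoting evaluation at $\underline{\boldsymbol F}^\pm$, define $$\mathcal M_\pm=\begin{pmatrix} \mathrm i\xi(\boldsymbol B_1^{1\pm})^{-1}\boldsymbol B_2^{1\pm} & -(\boldsymbol B_1^{1\pm})^{-1}\\ \xi^2\boldsymbol B_1^{2\pm}(\boldsymbol B_1^{1\pm})^{-1}\boldsymbol B_2^{1\pm}-\lambda^2\mathbf I_2-\xi^2\boldsymbol B_2^{2\pm} & \mathrm i\xi\boldsymbol B_1^{2\pm}(\boldsymbol B_1^{1\pm})^{-1}\end{pmatrix}\in\mathbb C^{4\times4},$$ $$\mathcal K_\pm=\begin{pmatrix}\mathrm i\xi(\boldsymbol B_1^{1\pm})^{-1}\boldsymbol B_2^{1\pm}&-(\boldsymbol B_1^{1\pm})^{-1}\\-\mathrm i\xi\mathbf I_2&0\\-\lambda\mathbf I_2&0\end{pmatrix}\in\mathbb C^{6\times4}.$$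 For $(\lambda,\xi)\in\Gamma^+$, $\widetilde{\mathcal R}^s_-$ (resp. $\widetilde{\mathcal R}^u_+$) is the $4\times2$ matrix whose columns form the basis of the stable invariant subspace of $\mathcal M_-$ (eigenvalues with negative real part), resp. the unstable invariant subspace of $\mathcal M_+$ (eigenvalues with positive real part), normalized so that its upper $2\times2$ block is $\mathbf I_2$; both are extended continuously to $\Gamma$. Put $$\widehat{\mathcal Q}=\begin{pmatrix}[\![\boldsymbol F_1]\!]\\-\mathrm i\xi[\![\boldsymbol\sigma(\boldsymbol F)_2]\!]\end{pmatrix},\quad \widehat q=-\lambda D_sg+\mathrm i\xi\,\hat{\boldsymbol e}_2\cdot D_{\boldsymbol n}g,$$ $$\widetilde p^+=(D_{(\boldsymbol F^+,\boldsymbol v^+)}g)\mathcal K_+\widetilde{\mathcal R}^u_+,\quad \widetilde p^-=-(D_{(\boldsymbol F^-,\boldsymbol v^-)}g)\mathcal K_-\widetilde{\mathcal R}^s_-,$$ where derivatives of $g$ are evaluated at $\big((\underline{\boldsymbol F}^-,\boldsymbol0),(\underline{\boldsymbol F}^+,\boldsymbol0),0,\hat{\boldsymbol e}_1\big)$ and $D_{(\boldsymbol F^\pm,\boldsymbol v^\pm)}g\in\mathbb R^{1\times6}$ is ordered as $(\boldsymbol F_1,\boldsymbol F_2,\boldsymbol v)$. The Lopatinskiĭ determinant is $$\Delta(\lambda,\xi)=\det\begin{pmatrix}\widetilde{\mathcal R}^s_-&\widehat{\mathcal Q}&\widetilde{\mathcal R}^u_+\\ \widetilde p^-&\widehat q&\widetilde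 p^+\end{pmatrix},\qquad(\lambda,\xi)\in\Gamma.$$ Stability notions. The phase boundary is: weakly stable if $\Delta$ has no zero in $\Gamma^+$; uniformly stable if $\Delta$ has no zero in $\Gamma$; strongly unstable if $\Delta$ has a zero in $\Gamma^+$. *)

theory Defs
  imports "HOL-Analysis.Analysis"
begin

section \<open>Stress and elasticity matrices of a stored energy\<close>

text \<open>\<open>F $ k $ j\<close> is the entry in row \<open>k\<close> and column \<open>j\<close>; the argument \<open>axis k (axis j 1)\<close> of a
  Frechet derivative makes it the partial derivative with respect to that entry.\<close>

definition stress :: "(real^2^2 \<Rightarrow> real) \<Rightarrow> real^2^2 \<Rightarrow> real^2^2" where
  "stress W F = (\<chi> k j. frechet_derivative W (at F) (axis k (axis j 1)))"

text \<open>\<open>elast W i j F\<close> is \<open>B\<^sub>i\<^sup>j(F)\<close>, i.e. the Jacobian of the \<open>j\<close>-th column of the stress with respect to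
  the \<open>i\<close>-th column of \<open>F\<close>.\<close>

definition elast :: "(real^2^2 \<Rightarrow> real) \<Rightarrow> 2 \<Rightarrow> 2 \<Rightarrow> real^2^2 \<Rightarrow> real^2^2" where
  "elast W i j F =
     (\<chi> k l. frechet_derivative (\<lambda>G. stress W G $ k $ j) (at F) (axis l (axis i 1)))"


section \<open>Kinetic rules\<close>

text \<open>A state is a pair of deformation gradient and velocity. A kinetic function takes the state on
  the minus side, the state on the plus side, the speed and the normal. It is given by a formula
  on all of \<open>real^2\<close> in the normal variable; only its derivative in the direction
  \<open>axis 2 1\<close>, tangential to the unit circle at \<open>axis 1 1\<close>, is used below.\<close>

type_synonym state = "(real^2^2) \<times> (real^2)"
type_synonym kinetic = "state \<Rightarrow> state \<Rightarrow> real \<Rightarrow> real^2 \<Rightarrow> real"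

definition kinetic_function :: "(real^2^2 \<Rightarrow> real) \<Rightarrow> kinetic \<Rightarrow> kinetic" where
  "kinetic_function W gt Um Up s n =
     W (fst Up) - W (fst Um)
     - n \<bullet> (transpose (fst Up - fst Um)
             *v (((1/2) *\<^sub>R (stress W (fst Up) + stress W (fst Um))) *v n))
     + gt Um Up s n"

definition maxwell_rule :: "(real^2^2 \<Rightarrow> real) \<Rightarrow> kinetic" where
  "maxwell_rule W = kinetic_function W (\<lambda>_ _ _ _. 0)"


section \<open>The matrices of the Lopatinskii determinant\<close>

definition cmat :: "real^'n^'m \<Rightarrow> complex^'n^'m" where
  "cmat A = (\<chi> i j. of_real (A $ i $ j))"

definition cvec :: "real^'n \<Rightarrow> complex^'n" where
  "cvec v = (\<chi> i. of_real (v $ i))"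

definition cscale :: "complex \<Rightarrow> complex^'n^'m \<Rightarrow> complex^'n^'m" where
  "cscale c A = (\<chi> i j. c * A $ i $ j)"

text \<open>Block vectors and matrices are indexed by sum types.\<close>

definition vstack :: "'a^'m \<Rightarrow> 'a^'n \<Rightarrow> 'a^('m + 'n)" where
  "vstack A B = (\<chi> i. case i of Inl k \<Rightarrow> A $ k | Inr k \<Rightarrow> B $ k)"

definition hstack :: "'a^'m^'r \<Rightarrow> 'a^'n^'r \<Rightarrow> 'a^('m + 'n)^'r" where
  "hstack A B = (\<chi> i. vstack (A $ i) (B $ i))"

definition M_matrix ::
    "(real^2^2 \<Rightarrow> real) \<Rightarrow> real^2^2 \<Rightarrow> complex \<Rightarrow> real \<Rightarrow> complex^(2+2)^(2+2)" where
  "M_matrix W F lam \<xi> =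
    (let B = (\<lambda>i j. cmat (elast W i j F)); Binv = matrix_inv (B 1 1) in
     vstack
       (hstack (cscale (\<i> * \<xi>) (Binv ** B 2 1)) (- Binv))
       (hstack (cscale (\<xi>\<^sup>2) (B 1 2 ** Binv ** B 2 1) - cscale (lam\<^sup>2) (mat 1) - cscale (\<xi>\<^sup>2) (B 2 2))
               (cscale (\<i> * \<xi>) (B 1 2 ** Binv))))"

definition K_matrix ::
    "(real^2^2 \<Rightarrow> real) \<Rightarrow> real^2^2 \<Rightarrow> complex \<Rightarrow> real \<Rightarrow> complex^(2+2)^(2+2+2)" where
  "K_matrix W F lam \<xi> =
    (let B = (\<lambda>i j. cmat (elast W i j F)); Binv = matrix_inv (B 1 1) in
     vstack (hstack (cscale (\<i> * \<xi>) (Binv ** B 2 1)) (- Binv))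
       (vstack (hstack (- cscale (\<i> * \<xi>) (mat 1)) 0)
               (hstack (- cscale lam (mat 1)) 0)))"


section \<open>Stable and unstable subspaces and their normalized bases\<close>

definition gen_eigenspace :: "complex^'n^'n \<Rightarrow> complex \<Rightarrow> (complex^'n) set" where
  "gen_eigenspace M \<nu> = {v. \<exists>m::nat. (((*v) (M - mat \<nu>)) ^^ m) v = 0}"

definition stable_subspace :: "complex^'n^'n \<Rightarrow> (complex^'n) set" where
  "stable_subspace M = vec.span (\<Union>\<nu>\<in>{\<nu>. Re \<nu> < 0}. gen_eigenspace M \<nu>)"

definition unstable_subspace :: "complex^'n^'n \<Rightarrow> (complex^'n) set" where
  "unstable_subspace M = vec.span (\<Union>\<nu>\<in>{\<nu>. Re \<nu> > 0}. gen_eigenspace M \<nu>)"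

definition is_normalized_basis :: "(complex^(2+2)) set \<Rightarrow> complex^2^(2+2) \<Rightarrow> bool" where
  "is_normalized_basis E R \<longleftrightarrow>
     vec.independent (columns R) \<and> vec.span (columns R) = E \<and> (\<chi> i. R $ Inl i) = mat 1"

text \<open>There is at most one normalized basis of a given subspace.\<close>

definition normalized_basis :: "(complex^(2+2)) set \<Rightarrow> complex^2^(2+2)" where
  "normalized_basis E = (THE R. is_normalized_basis E R)"

definition Gamma :: "(complex \<times> real) set" where
  "Gamma = {(lam, \<xi>). (cmod lam)\<^sup>2 + \<bar>\<xi>\<bar>\<^sup>2 = 1 \<and> Re lam \<ge> 0}"

definition Gamma_plus :: "(complex \<times> real) set" where
  "Gamma_plus = Gamma \<inter> {(lam, \<xi>). Re lam > 0}"

definition extend_to_Gamma :: "(complex \<times> real \<Rightarrow> 'a::t2_space) \<Rightarrow> complex \<times> real \<Rightarrow> 'a" where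
  "extend_to_Gamma f p = (if p \<in> Gamma_plus then f p else Lim (at p within Gamma_plus) f)"

definition R_stable ::
    "(real^2^2 \<Rightarrow> real) \<Rightarrow> real^2^2 \<Rightarrow> complex \<times> real \<Rightarrow> complex^2^(2+2)" where
  "R_stable W F =
     extend_to_Gamma (\<lambda>(lam, \<xi>). normalized_basis (stable_subspace (M_matrix W F lam \<xi>)))"

definition R_unstable ::
    "(real^2^2 \<Rightarrow> real) \<Rightarrow> real^2^2 \<Rightarrow> complex \<times> real \<Rightarrow> complex^2^(2+2)" where
  "R_unstable W F =
     extend_to_Gamma (\<lambda>(lam, \<xi>). normalized_basis (unstable_subspace (M_matrix W F lam \<xi>)))"


section \<open>The Lopatinskii determinant\<close>

text \<open>Row vector of the partial derivatives of a function of a state, in the order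
  (first column of \<open>F\<close>, second column of \<open>F\<close>, \<open>v\<close>).\<close>

definition state_gradient :: "(state \<Rightarrow> real) \<Rightarrow> state \<Rightarrow> real^(2+2+2)" where
  "state_gradient f U =
     (let D = frechet_derivative f (at U) in
      vstack (\<chi> k. D (axis k (axis 1 1), 0))
        (vstack (\<chi> k. D (axis k (axis 2 1), 0))
                (\<chi> k. D (0, axis k 1))))"

text \<open>Everything is evaluated at a static configuration: states \<open>(Fm, 0)\<close> and \<open>(Fp, 0)\<close>, speed \<open>0\<close>
  and normal \<open>axis 1 1\<close>.\<close>

definition Q_hat :: "(real^2^2 \<Rightarrow> real) \<Rightarrow> real^2^2 \<Rightarrow> real^2^2 \<Rightarrow> real \<Rightarrow> complex^(2+2)" where
  "Q_hat W Fm Fp \<xi> =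
     vstack (cvec (column 1 Fp - column 1 Fm))
            (- (\<i> * \<xi>) *s cvec (column 2 (stress W Fp) - column 2 (stress W Fm)))"

definition q_hat :: "kinetic \<Rightarrow> real^2^2 \<Rightarrow> real^2^2 \<Rightarrow> complex \<Rightarrow> real \<Rightarrow> complex" where
  "q_hat g Fm Fp lam \<xi> =
     - lam * of_real (deriv (\<lambda>s. g (Fm, 0) (Fp, 0) s (axis 1 1)) 0)
     + \<i> * \<xi> * of_real (frechet_derivative (\<lambda>n. g (Fm, 0) (Fp, 0) 0 n) (at (axis 1 1)) (axis 2 1))"

definition p_plus ::
    "(real^2^2 \<Rightarrow> real) \<Rightarrow> kinetic \<Rightarrow> real^2^2 \<Rightarrow> real^2^2 \<Rightarrow> complex \<times> real \<Rightarrow> complex^2" where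
  "p_plus W g Fm Fp p =
     cvec (state_gradient (\<lambda>U. g (Fm, 0) U 0 (axis 1 1)) (Fp, 0))
       v* (K_matrix W Fp (fst p) (snd p) ** R_unstable W Fp p)"

definition p_minus ::
    "(real^2^2 \<Rightarrow> real) \<Rightarrow> kinetic \<Rightarrow> real^2^2 \<Rightarrow> real^2^2 \<Rightarrow> complex \<times> real \<Rightarrow> complex^2" where
  "p_minus W g Fm Fp p =
     - (cvec (state_gradient (\<lambda>U. g U (Fp, 0) 0 (axis 1 1)) (Fm, 0))
       v* (K_matrix W Fm (fst p) (snd p) ** R_stable W Fm p))"

definition lopatinskii ::
    "(real^2^2 \<Rightarrow> real) \<Rightarrow> kinetic \<Rightarrow> real^2^2 \<Rightarrow> real^2^2 \<Rightarrow> complex \<times> real \<Rightarrow> complex" where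
  "lopatinskii W g Fm Fp p =
    (let Rm = R_stable W Fm p; Rp = R_unstable W Fp p;
         Q = Q_hat W Fm Fp (snd p); q = q_hat g Fm Fp (fst p) (snd p);
         pm = p_minus W g Fm Fp p; pp = p_plus W g Fm Fp p
     in det (vector
       [vector [Rm $ Inl 1 $ 1, Rm $ Inl 1 $ 2, Q $ Inl 1, Rp $ Inl 1 $ 1, Rp $ Inl 1 $ 2],
        vector [Rm $ Inl 2 $ 1, Rm $ Inl 2 $ 2, Q $ Inl 2, Rp $ Inl 2 $ 1, Rp $ Inl 2 $ 2],
        vector [Rm $ Inr 1 $ 1, Rm $ Inr 1 $ 2, Q $ Inr 1, Rp $ Inr 1 $ 1, Rp $ Inr 1 $ 2],
        vector [Rm $ Inr 2 $ 1, Rm $ Inr 2 $ 2, Q $ Inr 2, Rp $ Inr 2 $ 1, Rp $ Inr 2 $ 2],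
        vector [pm $ 1, pm $ 2, q, pp $ 1, pp $ 2]] :: complex^5^5))"

definition weakly_stable ::
    "(real^2^2 \<Rightarrow> real) \<Rightarrow> kinetic \<Rightarrow> real^2^2 \<Rightarrow> real^2^2 \<Rightarrow> bool" where
  "weakly_stable W g Fm Fp \<longleftrightarrow> (\<forall>p\<in>Gamma_plus. lopatinskii W g Fm Fp p \<noteq> 0)"

definition uniformly_stable ::
    "(real^2^2 \<Rightarrow> real) \<Rightarrow> kinetic \<Rightarrow> real^2^2 \<Rightarrow> real^2^2 \<Rightarrow> bool" where
  "uniformly_stable W g Fm Fp \<longleftrightarrow> (\<forall>p\<in>Gamma. lopatinskii W g Fm Fp p \<noteq> 0)"

definition strongly_unstable ::
    "(real^2^2 \<Rightarrow> real) \<Rightarrow> kinetic \<Rightarrow> real^2^2 \<Rightarrow> real^2^2 \<Rightarrow> bool" where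
  "strongly_unstable W g Fm Fp \<longleftrightarrow> (\<exists>p\<in>Gamma_plus. lopatinskii W g Fm Fp p = 0)"


section \<open>The Hadamard material and its phase boundary\<close>

definition hadamard_h :: "real \<Rightarrow> real \<Rightarrow> real" where
  "hadamard_h J0 J = 1 / (4 * J0) * ((J0 - J)\<^sup>2 - 1)\<^sup>2"

definition hadamard_energy :: "real \<Rightarrow> real \<Rightarrow> real^2^2 \<Rightarrow> real" where
  "hadamard_energy J0 \<mu> F = \<mu> / 2 * trace (transpose F ** F) + hadamard_h J0 (det F)"

definition theta0 :: "real \<Rightarrow> real \<Rightarrow> real" where
  "theta0 J0 \<mu> = 3 * \<mu> * J0 / 2"

definition F_minus :: "real \<Rightarrow> real \<Rightarrow> real^2^2" where
  "F_minus J0 \<mu> =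
     vector [vector [(J0 - 1 / sqrt 3) * (1 / sqrt (theta0 J0 \<mu>)), 0],
             vector [0, sqrt (theta0 J0 \<mu>)]]"

definition F_plus :: "real \<Rightarrow> real \<Rightarrow> real^2^2" where
  "F_plus J0 \<mu> =
     vector [vector [(J0 + 1 / sqrt 3) * (1 / sqrt (theta0 J0 \<mu>)), 0],
             vector [0, sqrt (theta0 J0 \<mu>)]]"

definition delta1 :: "real \<Rightarrow> real \<Rightarrow> real" where
  "delta1 J0 \<mu> = 1 - 4 / (27 * J0\<^sup>2 * \<mu>\<^sup>2) - 4 / (9 * \<mu>\<^sup>2)"

definition mu_star :: "real \<Rightarrow> real" where
  "mu_star J0 = 2 / 3 * sqrt (1 + 1 / (3 * J0\<^sup>2))"

end

theory Submission
  imports Defs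
begin

text \<open>
  At both phases \<open>det F = J\<^sub>0 \<plusminus> 1/\<surd>3\<close> is an inflection point of \<open>h\<close>, so the second derivative of the
  energy there is that of \<open>\<mu>/2 |F|\<^sup>2\<close> plus the multiple \<open>\<epsilon> = h'(det F)\<close> of the null form \<open>det\<close>.
  Hence \<open>M\<^sup>2 = b\<^sup>2\<close> with \<open>\<mu> b\<^sup>2 = \<lambda>\<^sup>2 + \<mu> \<xi>\<^sup>2\<close>, the stable and unstable subspaces are the kernels
  of \<open>M \<plusminus> b\<close>, and the Lopatinskii determinant vanishes exactly when
  \<open>\<lambda>\<^sup>2 = - \<mu> \<delta>\<^sub>1 \<xi>\<^sup>2\<close>. This has a root with positive real part iff \<open>\<delta>\<^sub>1 < 0\<close>.
\<close>

section \<open>The index type of size five, kernels and block vectors\<close>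

lemma exhaust_5:
  fixes x :: 5
  shows "x = 1 \<or> x = 2 \<or> x = 3 \<or> x = 4 \<or> x = 5"
proof (induct x)
  case (of_int z)
  then have "z = 0 \<or> z = 1 \<or> z = 2 \<or> z = 3 \<or> z = 4"
    by fastforce
  then show ?case by auto
qed

lemma forall_5: "(\<forall>i::5. P i) \<longleftrightarrow> P 1 \<and> P 2 \<and> P 3 \<and> P 4 \<and> P 5"
  by (metis exhaust_5)

lemma UNIV_5: "(UNIV :: 5 set) = {1, 2, 3, 4, 5}"
  using exhaust_5 by auto

lemma sum_5: "sum f (UNIV :: 5 set) = f 1 + f 2 + f 3 + f 4 + f 5"
  unfolding UNIV_5 by (simp add: ac_simps)

lemma vector_5 [simp]:
  "(vector [a, b, c, d, e] :: 'a::zero^5) $ 1 = a"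
  "(vector [a, b, c, d, e] :: 'a::zero^5) $ 2 = b"
  "(vector [a, b, c, d, e] :: 'a::zero^5) $ 3 = c"
  "(vector [a, b, c, d, e] :: 'a::zero^5) $ 4 = d"
  "(vector [a, b, c, d, e] :: 'a::zero^5) $ 5 = e"
  unfolding vector_def by auto

text \<open>Turns the vanishing of the 5 by 5 determinant into a homogeneous linear system, which
  elimination solves without expanding the determinant.\<close>

lemma det_eq_0_iff_ker:
  fixes A :: "'a::field^'n^'n"
  shows "det A = 0 \<longleftrightarrow> (\<exists>x. x \<noteq> 0 \<and> A *v x = 0)"
  using invertible_det_nz[of A] matrix_left_invertible_ker[of A]
    invertible_left_inverse[of A] by auto

lemma vstack_nth [simp]: "vstack A B $ Inl i = A $ i" "vstack A B $ Inr j = B $ j"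
  by (simp_all add: vstack_def)

lemma hstack_nth [simp]: "hstack A B $ i = vstack (A $ i) (B $ i)"
  by (simp add: hstack_def)

lemma vec_eq_vstack_iff:
  "v = w \<longleftrightarrow> (\<forall>i. v $ Inl i = w $ Inl i) \<and> (\<forall>j. v $ Inr j = w $ Inr j)"
  for v w :: "'a^('m::finite + 'n::finite)"
  by (auto simp: vec_eq_iff split_sum_all)

lemma sum_UNIV_Plus:
  "sum f (UNIV :: ('m::finite + 'n::finite) set) = (\<Sum>i\<in>UNIV. f (Inl i)) + (\<Sum>j\<in>UNIV. f (Inr j))"
  by (subst UNIV_Plus_UNIV[symmetric], subst sum.Plus) (auto simp: comp_def)

lemma mat_matrix_vector_mult: "mat c *v x = c *s x"
  for x :: "'a::comm_semiring_1^'n"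
  by (simp add: mat_def matrix_vector_mult_def vec_eq_iff if_distrib [of "\<lambda>x. x * y" for y]
      sum.delta cong: if_cong)

section \<open>Spectral subspaces of a matrix whose square is scalar\<close>

text \<open>Since M^2 = b^2, every vector in the image of M + b satisfies M u = b u. On it the
  powers of M - \<nu> act as powers of the nonzero number b - \<nu>, so M + b must annihilate each
  generalized eigenvector for \<nu>.\<close>

lemma gen_eigenspace_involution:
  fixes M :: "complex^'n^'n"
  assumes sq: "\<And>v. M *v (M *v v) = b\<^sup>2 *s v"
    and v: "v \<in> gen_eigenspace M \<nu>" and "\<nu> \<noteq> b"
  shows "M *v v = (- b) *s v"
proof -
  define T where "T = (*v) (M - mat \<nu>)"
  have T: "T x = M *v x - \<nu> *s x" for x
    by (simp add: T_def matrix_vector_mult_diff_rdistrib mat_matrix_vector_mult)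
  obtain m where m: "(T ^^ m) v = 0"
    using v by (auto simp: gen_eigenspace_def T_def)
  define u where "u = M *v v + b *s v"
  have Mu: "M *v u = b *s u"
    by (simp add: u_def sq matrix_vector_right_distrib vector_scalar_commute vec_eq_iff
        power2_eq_square algebra_simps)
  have "(T ^^ k) u = (b - \<nu>) ^ k *s u" for k
  proof (induction k)
    case (Suc k)
    then show ?case
      by (simp add: T[of "_ *s _"] Mu vector_scalar_commute) (simp add: vec_eq_iff algebra_simps)
  qed simp
  \<comment> \<open>\<open>T\<close> commutes with M + b, so the power that kills v kills u as
    well.\<close>
  moreover have "(T ^^ k) u = M *v (T ^^ k) v + b *s (T ^^ k) v" for k
  proof (induction k)
    case (Suc k)
    have "(T ^^ Suc k) u = T (M *v (T ^^ k) v + b *s (T ^^ k) v)"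
      using Suc by simp
    then show ?case
      unfolding funpow.simps o_apply T[of "(T ^^ k) v"] T[of "_ + _"]
      by (simp add: matrix_vector_right_distrib matrix_vector_mult_diff_distrib
          vector_scalar_commute vec_eq_iff algebra_simps)
  qed (simp add: u_def)
  ultimately have "(b - \<nu>) ^ m *s u = M *v (T ^^ m) v + b *s (T ^^ m) v"
    by metis
  then have "(b - \<nu>) ^ m *s u = 0"
    by (simp add: m)
  with \<open>\<nu> \<noteq> b\<close> have "u = 0"
    by (auto simp: vec_eq_iff)
  then show ?thesis
    by (simp add: u_def vec_eq_iff add_eq_0_iff2)
qed

text \<open>Every generalized eigenspace in the union lies in the kernel of M + b, and the one for
  -b is all of it, so the union is already a subspace. For Re b > 0, taking the left half-plane as A
  gives the stable subspace; the right half-plane with -b in place of b gives the unstable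
  one.\<close>

lemma span_gen_eigenspaces_involution:
  fixes M :: "complex^'n^'n"
  assumes sq: "\<And>v. M *v (M *v v) = b\<^sup>2 *s v" and "- b \<in> A" and "b \<notin> A"
  shows "vec.span (\<Union>\<nu>\<in>A. gen_eigenspace M \<nu>) = {v. M *v v = (- b) *s v}"
proof -
  have "v \<in> gen_eigenspace M (- b)" if "M *v v = (- b) *s v" for v
    using that unfolding gen_eigenspace_def
    by (auto intro!: exI[of _ 1]
        simp: matrix_vector_mult_diff_rdistrib mat_matrix_vector_mult)
  then have "(\<Union>\<nu>\<in>A. gen_eigenspace M \<nu>) = {v. M *v v = (- b) *s v}"
    using gen_eigenspace_involution[OF sq] assms(2,3) by blast
  moreover have "vec.subspace {v. M *v v = (- b) *s v}"
    by (auto simp: vec.subspace_def matrix_vector_right_distrib vector_scalar_commute vec_eq_iff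
        algebra_simps)
  ultimately show ?thesis
    by (simp add: vec.span_eq_iff)
qed

text \<open>On a graph over the upper block, the upper half of a vector determines the lower half.
  Hence the upper block \<open>mat 1\<close> fixes every column, which settles the
  \<open>THE\<close> in \<open>normalized_basis\<close>, and the coordinates of a vector are its
  upper entries.\<close>

lemma normalized_basis_graph:
  fixes L :: "complex^2^2"
  assumes E: "E = {v. (\<chi> j. v $ Inr j) = L *v (\<chi> i. v $ Inl i)}"
  shows "normalized_basis E = vstack (mat 1) L"
proof -
  have mem: "v \<in> E \<longleftrightarrow> v $ Inr 1 = L $ 1 $ 1 * v $ Inl 1 + L $ 1 $ 2 * v $ Inl 2 \<and>
      v $ Inr 2 = L $ 2 $ 1 * v $ Inl 1 + L $ 2 $ 2 * v $ Inl 2" for v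
    by (simp add: E vec_eq_iff matrix_vector_mult_def sum_2 forall_2)
  define R :: "complex^2^(2+2)" where "R = vstack (mat 1) L"
  have cols: "columns R' = {column 1 R', column 2 R'}" for R' :: "complex^2^(2+2)"
    by (auto simp: columns_def) (metis exhaust_2)
  have comb: "v = v $ Inl 1 *s column 1 R + v $ Inl 2 *s column 2 R" if "v \<in> E" for v
    using that by (simp add: vec_eq_vstack_iff mem forall_2 R_def column_def mat_def algebra_simps)
  have "column j R \<in> E" for j
    by (simp add: mem R_def column_def mat_def) (metis exhaust_2)
  moreover have "vec.subspace E"
    by (auto simp: vec.subspace_def mem algebra_simps)
  ultimately have "vec.span (columns R) \<subseteq> E"
    by (intro vec.span_minimal) (auto simp: cols)
  moreover have "E \<subseteq> vec.span (columns R)"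
    using comb by (metis cols insertCI subsetI vec.span_add vec.span_base vec.span_scale)
  moreover have "vec.independent (columns R)"
  proof -
    have "column 1 R $ Inl 1 = 1" "column 2 R $ Inl 1 = 0" "column 2 R $ Inl 2 = 1"
      by (simp_all add: R_def column_def mat_def)
    then have "column 2 R \<noteq> 0" "\<And>c. column 1 R \<noteq> c *s column 2 R"
      by (metis zero_index zero_neq_one, metis mult_zero_right vector_smult_component zero_neq_one)
    then show ?thesis
      by (auto simp: cols vec.independent_insert vec.span_singleton vec.dependent_single)
  qed
  moreover have "(\<chi> i. R $ Inl i) = mat 1"
    by (simp add: R_def vec_eq_iff)
  ultimately have R: "is_normalized_basis E R"
    by (auto simp: is_normalized_basis_def)
  have "R' = R" if R': "is_normalized_basis E R'" for R'
  proof -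
    have "column j R' \<in> E" for j
      using R' vec.span_base[of "column j R'" "columns R'"]
      by (auto simp: is_normalized_basis_def columns_def)
    then have "\<forall>j. column j R' \<in> E" ..
    moreover have "R' $ Inl i = mat 1 $ i" for i
      using R' by (simp add: is_normalized_basis_def vec_eq_iff)
    ultimately show ?thesis
      by (simp add: vec_eq_vstack_iff forall_2 mem R_def vec_eq_iff[of "R' $ _"] column_def mat_def)
  qed
  with R show ?thesis
    unfolding normalized_basis_def R_def by blast
qed

text \<open>If the root b were purely imaginary, \<mu> (b^2 - x^2) would be real and at most 0. It
  equals lam^2, which avoids that half-line when Re lam > 0. The principal root has Re b \<ge> 0
  from the start.\<close>

lemma csqrt_Re_pos:
  assumes "Re lam > 0" and "\<mu> > 0"
  shows "Re (csqrt (lam\<^sup>2 / of_real \<mu> + of_real (x\<^sup>2))) > 0"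
proof -
  define b where "b = csqrt (lam\<^sup>2 / of_real \<mu> + of_real (x\<^sup>2))"
  have b: "of_real \<mu> * (b\<^sup>2 - of_real (x\<^sup>2)) = lam\<^sup>2"
    using assms by (simp add: b_def field_simps)
  have "Re b \<noteq> 0"
  proof
    assume "Re b = 0"
    then have "Im (of_real \<mu> * (b\<^sup>2 - of_real (x\<^sup>2))) = 0"
      "Re (of_real \<mu> * (b\<^sup>2 - of_real (x\<^sup>2))) \<le> 0"
      using \<open>\<mu> > 0\<close> by (simp_all add: power2_eq_square mult_le_0_iff)
    with \<open>Re lam > 0\<close> show False
      unfolding b by (auto simp: power2_eq_square mult_le_0_iff)
  qed
  moreover have "Re b \<ge> 0"
    using csqrt_principal[of "lam\<^sup>2 / of_real \<mu> + of_real (x\<^sup>2)"] by (auto simp: b_def)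
  ultimately show ?thesis
    by (simp add: b_def)
qed

section \<open>Bases and coefficient matrices for a skew coupling of the columns\<close>

text \<open>The mixed second derivatives of \<open>det\<close>: entry (k, l) differentiates in
  \<open>F $ k $ 1\<close> and \<open>F $ l $ 2\<close>.\<close>

definition rot90 :: "real^2^2" where
  "rot90 = vector [vector [0, 1], vector [-1, 0]]"

text \<open>These are the second derivatives of \<mu>/2 |F|^2 + \<epsilon> det F. Both phases have
  this form, with opposite \<epsilon>, so one computation is interpreted twice.\<close>

locale skew_elasticity =
  fixes W :: "real^2^2 \<Rightarrow> real" and F :: "real^2^2" and \<mu> \<epsilon> :: real
  assumes mu_pos: "\<mu> > 0"
    and elast_11: "elast W 1 1 F = mat \<mu>"
    and elast_22: "elast W 2 2 F = mat \<mu>"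
    and elast_21: "elast W 2 1 F = \<epsilon> *\<^sub>R rot90"
    and elast_12: "elast W 1 2 F = - \<epsilon> *\<^sub>R rot90"
begin

lemma cmat_elast:
  "cmat (elast W 1 1 F) = mat (of_real \<mu>)"
  "cmat (elast W 2 2 F) = mat (of_real \<mu>)"
  "cmat (elast W 2 1 F) = vector [vector [0, of_real \<epsilon>], vector [- of_real \<epsilon>, 0]]"
  "cmat (elast W 1 2 F) = vector [vector [0, - of_real \<epsilon>], vector [of_real \<epsilon>, 0]]"
  by (simp_all add: elast_11 elast_22 elast_21 elast_12 cmat_def rot90_def vec_eq_iff forall_2 mat_def)

lemma matrix_inv_elast_11: "matrix_inv (mat (of_real \<mu>) :: complex^2^2) = mat (1 / of_real \<mu>)"
proof -
  let ?A = "mat (of_real \<mu>) :: complex^2^2" and ?B = "mat (1 / of_real \<mu>) :: complex^2^2"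
  have AB: "?A ** ?B = mat 1"
    using mu_pos by (simp add: matrix_matrix_mult_def mat_def vec_eq_iff forall_2 sum_2)
  then have "invertible ?A"
    by (metis invertible_right_inverse)
  then have "matrix_inv ?A ** ?A = mat 1"
    unfolding invertible_def matrix_inv_def by (rule someI2_ex) auto
  then have "matrix_inv ?A ** (?A ** ?B) = ?B"
    by (metis matrix_mul_assoc matrix_mul_lid)
  with AB show ?thesis
    by simp
qed

text \<open>Because \<open>rot90\<close> squares to minus the identity, the product of the two
  coupling matrices is scalar, and so is the lower left block of M.\<close>

lemma M_matrix_mult:
  fixes lam :: complex
  shows "M_matrix W F lam \<xi> *v v = vstack
     (vector [(\<i> * \<xi> * \<epsilon> * v $ Inl 2 - v $ Inr 1) / \<mu>, (- \<i> * \<xi> * \<epsilon> * v $ Inl 1 - v $ Inr 2) / \<mu>])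
     (vector [(\<xi>\<^sup>2 * \<epsilon>\<^sup>2 / \<mu> - lam\<^sup>2 - \<xi>\<^sup>2 * \<mu>) * v $ Inl 1 - \<i> * \<xi> * \<epsilon> / \<mu> * v $ Inr 2,
              (\<xi>\<^sup>2 * \<epsilon>\<^sup>2 / \<mu> - lam\<^sup>2 - \<xi>\<^sup>2 * \<mu>) * v $ Inl 2 + \<i> * \<xi> * \<epsilon> / \<mu> * v $ Inr 1])"
  using mu_pos
  unfolding M_matrix_def Let_def cmat_elast matrix_inv_elast_11
  by (simp add: vec_eq_vstack_iff forall_2
      matrix_vector_mult_def matrix_matrix_mult_def sum_UNIV_Plus sum_2 cscale_def mat_def
      power2_eq_square field_simps)

text \<open>In blocks M is [A, -1/\<mu>; c, -A], with c scalar and A a multiple of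
  \<open>rot90\<close>. In the square the off-diagonal blocks cancel and both diagonal blocks are
  A^2 - c/\<mu>. There the terms in \<epsilon> cancel too, leaving lam^2/\<mu> + \<xi>^2 =
  b^2.\<close>

lemma M_matrix_square:
  fixes b lam :: complex
  assumes "\<mu> * b\<^sup>2 = lam\<^sup>2 + \<mu> * \<xi>\<^sup>2"
  shows "M_matrix W F lam \<xi> *v (M_matrix W F lam \<xi> *v v) = b\<^sup>2 *s v"
proof -
  have lam2: "lam\<^sup>2 = \<mu> * b\<^sup>2 - \<mu> * \<xi>\<^sup>2"
    using assms by simp
  show ?thesis
    unfolding M_matrix_mult lam2 using mu_pos
    by (simp add: vec_eq_vstack_iff forall_2 power2_eq_square field_simps)
qed

text \<open>The upper two equations of M v = b v already give the lower half of v as a linear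
  function of the upper half; the lower two then follow from the relation between b and lam. Either
  root b is allowed, so this covers both phases.\<close>

lemma normalized_basis_eigenspace:
  fixes b lam :: complex
  assumes "\<mu> * b\<^sup>2 = lam\<^sup>2 + \<mu> * \<xi>\<^sup>2"
  shows "normalized_basis {v. M_matrix W F lam \<xi> *v v = b *s v}
    = vstack (mat 1) (vector [vector [- \<mu> * b, \<i> * \<xi> * \<epsilon>], vector [- \<i> * \<xi> * \<epsilon>, - \<mu> * b]])"
proof (rule normalized_basis_graph, rule Collect_cong, rule iffI)
  fix v :: "complex^(2+2)"
  assume "M_matrix W F lam \<xi> *v v = b *s v"
  then have "(M_matrix W F lam \<xi> *v v) $ Inl j = b * v $ Inl j" for j
    by simp
  from this[of 1] this[of 2] show "(\<chi> j. v $ Inr j) = vector [vector [- \<mu> * b, \<i> * \<xi> * \<epsilon>], vector [- \<i> * \<xi> * \<epsilon>, - \<mu> * b]]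
      *v (\<chi> i. v $ Inl i)"
    using mu_pos
    unfolding M_matrix_mult
    by (simp add: vec_eq_iff forall_2 matrix_vector_mult_def sum_2 field_simps)
next
  fix v :: "complex^(2+2)"
  assume "(\<chi> j. v $ Inr j) = vector [vector [- \<mu> * b, \<i> * \<xi> * \<epsilon>], vector [- \<i> * \<xi> * \<epsilon>, - \<mu> * b]]
      *v (\<chi> i. v $ Inl i)"
  then have v: "v $ Inr 1 = - (\<mu> * b * v $ Inl 1) + \<i> * \<xi> * \<epsilon> * v $ Inl 2"
    "v $ Inr 2 = - (\<i> * \<xi> * \<epsilon> * v $ Inl 1) - \<mu> * b * v $ Inl 2"
    by (simp_all add: vec_eq_iff forall_2 matrix_vector_mult_def sum_2)
  have lam2: "lam\<^sup>2 = \<mu> * b\<^sup>2 - \<mu> * \<xi>\<^sup>2"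
    using assms by simp
  show "M_matrix W F lam \<xi> *v v = b *s v"
    unfolding M_matrix_mult lam2 using mu_pos
    by (simp add: v vec_eq_vstack_iff forall_2 power2_eq_square field_simps)
qed

lemma R_stable_eq:
  fixes b lam :: complex
  assumes "(lam, \<xi>) \<in> Gamma_plus" and b: "\<mu> * b\<^sup>2 = lam\<^sup>2 + \<mu> * \<xi>\<^sup>2" and "Re b > 0"
  shows "R_stable W F (lam, \<xi>)
    = vstack (mat 1) (vector [vector [\<mu> * b, \<i> * \<xi> * \<epsilon>], vector [- \<i> * \<xi> * \<epsilon>, \<mu> * b]])"
proof -
  have "stable_subspace (M_matrix W F lam \<xi>) = {v. M_matrix W F lam \<xi> *v v = (- b) *s v}"
    unfolding stable_subspace_def
    by (rule span_gen_eigenspaces_involution[OF M_matrix_square[OF b]]) (use \<open>Re b > 0\<close> in auto)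
  then show ?thesis
    using assms normalized_basis_eigenspace[of "- b" lam \<xi>]
    by (simp add: R_stable_def extend_to_Gamma_def)
qed

lemma R_unstable_eq:
  fixes b lam :: complex
  assumes "(lam, \<xi>) \<in> Gamma_plus" and b: "\<mu> * b\<^sup>2 = lam\<^sup>2 + \<mu> * \<xi>\<^sup>2" and "Re b > 0"
  shows "R_unstable W F (lam, \<xi>)
    = vstack (mat 1) (vector [vector [- \<mu> * b, \<i> * \<xi> * \<epsilon>], vector [- \<i> * \<xi> * \<epsilon>, - \<mu> * b]])"
proof -
  have b': "of_real \<mu> * (- b)\<^sup>2 = lam\<^sup>2 + \<mu> * \<xi>\<^sup>2"
    using b by simp
  have "unstable_subspace (M_matrix W F lam \<xi>) = {v. M_matrix W F lam \<xi> *v v = (- (- b)) *s v}"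
    unfolding unstable_subspace_def
    by (rule span_gen_eigenspaces_involution[OF M_matrix_square[OF b']]) (use \<open>Re b > 0\<close> in auto)
  then show ?thesis
    using assms normalized_basis_eigenspace[of b lam \<xi>]
    by (simp add: R_unstable_def extend_to_Gamma_def)
qed

text \<open>The first block row of K is that of M, and the basis was obtained by solving exactly
  these rows for the eigenvalue b. This leaves b times the identity, free of \<epsilon>.\<close>

lemma K_matrix_mult:
  fixes b lam :: complex
  shows "K_matrix W F lam \<xi> **
      vstack (mat 1) (vector [vector [- \<mu> * b, \<i> * \<xi> * \<epsilon>], vector [- \<i> * \<xi> * \<epsilon>, - \<mu> * b]])
    = vstack (mat b) (vstack (mat (- \<i> * \<xi>)) (mat (- lam)))"
  using mu_pos
  unfolding K_matrix_def Let_def cmat_elast matrix_inv_elast_11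
  by (simp add: vec_eq_vstack_iff vec_eq_iff forall_2 split_sum_all
      matrix_matrix_mult_def sum_UNIV_Plus sum_2 cscale_def mat_def field_simps)

end

section \<open>The Maxwell rule and its derivatives\<close>

lemma has_derivative_entry [derivative_intros]:
  fixes f :: "'a::real_normed_vector \<Rightarrow> real^'n^'m"
  assumes "(f has_derivative f') net"
  shows "((\<lambda>x. f x $ i $ j) has_derivative (\<lambda>x. f' x $ i $ j)) net"
  by (intro bounded_linear.has_derivative[OF bounded_linear_vec_nth] assms)

text \<open>The Maxwell kinetic function at the normal \<open>axis 1 1\<close>, with G on the minus
  side and F on the plus side. It depends on the deformation gradients alone.\<close>

definition maxwell_gap :: "(real^2^2 \<Rightarrow> real) \<Rightarrow> real^2^2 \<Rightarrow> real^2^2 \<Rightarrow> real" where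
  "maxwell_gap W G F = W F - W G
     - (\<Sum>k\<in>UNIV. (F $ k $ 1 - G $ k $ 1) * (1/2 * (stress W F $ k $ 1 + stress W G $ k $ 1)))"

lemma maxwell_rule_axis_1: "maxwell_rule W Um Up s (axis 1 1) = maxwell_gap W (fst Um) (fst Up)"
  by (simp add: maxwell_rule_def kinetic_function_def maxwell_gap_def inner_vec_def sum_2
      matrix_vector_mult_def transpose_def axis_def field_simps)

lemma maxwell_gap_swap: "maxwell_gap W G F = - maxwell_gap W F G"
  by (simp add: maxwell_gap_def sum_2 field_simps)

text \<open>The gradient in F for fixed G. In the first column the average stress is subtracted from
  the stress at F, which leaves half the jump. The derivative in G follows by antisymmetry.\<close>

definition maxwell_gap_gradient :: "(real^2^2 \<Rightarrow> real) \<Rightarrow> real^2^2 \<Rightarrow> real^2^2 \<Rightarrow> real^(2+2+2)" where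
  "maxwell_gap_gradient W G F = vstack
     (\<chi> k. 1/2 * (stress W F $ k $ 1 - stress W G $ k $ 1)
        - 1/2 * (\<Sum>l\<in>UNIV. (F $ l $ 1 - G $ l $ 1) * elast W 1 1 F $ l $ k))
     (vstack (\<chi> k. stress W F $ k $ 2
        - 1/2 * (\<Sum>l\<in>UNIV. (F $ l $ 1 - G $ l $ 1) * elast W 2 1 F $ l $ k)) 0)"

lemma state_gradient_eq:
  assumes "(f has_derivative D) (at U)"
  shows "state_gradient f U = vstack (\<chi> k. D (axis k (axis 1 1), 0))
        (vstack (\<chi> k. D (axis k (axis 2 1), 0)) (\<chi> k. D (0, axis k 1)))"
  using frechet_derivative_at[OF assms] by (simp add: state_gradient_def Let_def)

lemma maxwell_gap_has_derivative:
  assumes "W differentiable at F" and "\<And>k. (\<lambda>H. stress W H $ k $ 1) differentiable at F"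
  shows "((\<lambda>U. maxwell_gap W G (fst U)) has_derivative
    (\<lambda>(H, w). frechet_derivative W (at F) H - (\<Sum>k\<in>UNIV.
        H $ k $ 1 * (1/2 * (stress W F $ k $ 1 + stress W G $ k $ 1))
        + (F $ k $ 1 - G $ k $ 1) * (1/2 * frechet_derivative (\<lambda>H. stress W H $ k $ 1) (at F) H))))
    (at (F, v))"
proof -
  have "(W has_derivative frechet_derivative W (at F)) (at (fst (F, v)))"
    "((\<lambda>H. stress W H $ k $ 1) has_derivative
      frechet_derivative (\<lambda>H. stress W H $ k $ 1) (at F)) (at (fst (F, v)))" for k
    using assms by (simp_all add: frechet_derivative_works[symmetric])
  note [derivative_intros] = this[THEN has_derivative_compose[OF has_derivative_fst[OF has_derivative_ident]]]
  show ?thesis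
    unfolding maxwell_gap_def
    by (rule derivative_eq_intros refl)+ (auto simp: fun_eq_iff sum_2 algebra_simps)
qed

lemma state_gradient_maxwell_gap:
  assumes "W differentiable at F" and "\<And>k. (\<lambda>H. stress W H $ k $ 1) differentiable at F"
  shows "state_gradient (\<lambda>U. maxwell_gap W G (fst U)) (F, v) = maxwell_gap_gradient W G F"
    and "state_gradient (\<lambda>U. maxwell_gap W (fst U) G) (F, v) = - maxwell_gap_gradient W G F"
proof -
  note D = maxwell_gap_has_derivative[OF assms, of G v]
  \<comment> \<open>Velocity directions feed the zero matrix to these derivatives.\<close>
  have lin: "frechet_derivative W (at F) 0 = 0"
    "frechet_derivative (\<lambda>H. stress W H $ k $ 1) (at F) 0 = 0" for k
    using assms by (simp_all add: linear_frechet_derivative linear_0)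
  have entries: "frechet_derivative W (at F) (axis k (axis j 1)) = stress W F $ k $ j"
    "frechet_derivative (\<lambda>H. stress W H $ k $ 1) (at F) (axis l (axis i 1)) = elast W i 1 F $ k $ l"
    "axis k (axis j (1::real)) $ l $ i = (if k = l \<and> j = i then 1 else 0)" for i j k l :: 2
    by (auto simp: stress_def elast_def) (auto simp: axis_def)
  show "state_gradient (\<lambda>U. maxwell_gap W G (fst U)) (F, v) = maxwell_gap_gradient W G F"
    unfolding state_gradient_eq[OF D] maxwell_gap_gradient_def
    by (simp add: vec_eq_vstack_iff forall_2 split_sum_all sum_2 lin entries field_simps)
  show "state_gradient (\<lambda>U. maxwell_gap W (fst U) G) (F, v) = - maxwell_gap_gradient W G F"
    unfolding maxwell_gap_swap[of W "fst _"] state_gradient_eq[OF has_derivative_minus[OF D]]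
      maxwell_gap_gradient_def
    by (simp add: vec_eq_vstack_iff forall_2 split_sum_all sum_2 lin entries field_simps)
qed

text \<open>The rule is constant in the speed and, up to a constant, minus a quadratic form in the
  normal. Its derivative at \<open>axis 1 1\<close> along \<open>axis 2 1\<close> is minus the sum
  of the two off-diagonal entries of that form, and the hypothesis says that this sum is
  zero.\<close>

lemma q_hat_maxwell_eq_0:
  assumes "(\<Sum>k\<in>UNIV. (F $ k $ 1 - G $ k $ 1) * (stress W F $ k $ 2 + stress W G $ k $ 2)
      + (F $ k $ 2 - G $ k $ 2) * (stress W F $ k $ 1 + stress W G $ k $ 1)) = 0"
  shows "q_hat (maxwell_rule W) G F lam \<xi> = 0"
proof -
  define P where "P = transpose (F - G) ** ((1/2) *\<^sub>R (stress W F + stress W G))"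
  have g: "maxwell_rule W (G, 0) (F, 0) s n = W F - W G - n \<bullet> (P *v n)" for s n
    by (simp add: maxwell_rule_def kinetic_function_def P_def matrix_vector_mul_assoc)
  have "((\<lambda>n. W F - W G - n \<bullet> (P *v n)) has_derivative
      (\<lambda>h. - (axis 1 1 \<bullet> (P *v h) + h \<bullet> (P *v axis 1 1)))) (at (axis 1 1))"
    by (auto intro!: derivative_eq_intros
        bounded_linear.has_derivative[OF matrix_vector_mul_bounded_linear])
  moreover have "P $ 1 $ 2 + P $ 2 $ 1 = 0"
    using assms by (simp add: P_def matrix_matrix_mult_def transpose_def sum_2 algebra_simps)
      (simp add: field_simps)
  ultimately have "frechet_derivative (\<lambda>n. W F - W G - n \<bullet> (P *v n)) (at (axis 1 1)) (axis 2 1) = 0"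
    by (simp add: frechet_derivative_at[symmetric] inner_axis' matrix_vector_mult_basis column_def)
  then show ?thesis
    by (simp add: q_hat_def g)
qed

section \<open>The 5 by 5 determinant\<close>

text \<open>A kernel vector is governed by x2, x1 + x4 and x1 - x4. Eliminating the last two leaves
  one scalar equation for x2, whose coefficient is the stated quadratic.\<close>

lemma det_lopatinskii_array:
  fixes t y e a c :: complex
  assumes "t \<noteq> 0" "a \<noteq> 0"
  shows "det (vector
       [vector [1, 0, a, 1, 0],
        vector [0, 1, 0, 0, 1],
        vector [t, y * e, 0, - t, - (y * e)],
        vector [- (y * e), t, 2/3 * y * a, y * e, - t],
        vector [- (a * t / 2), - (a * y * (c + 1/3)), 0, - (a * t / 2), - (a * y * (c - 1/3))]]
          :: complex^5^5) = 0
    \<longleftrightarrow> t\<^sup>2 + y\<^sup>2 * (e\<^sup>2 + 4/9) = 0" (is "det ?A = 0 \<longleftrightarrow> ?D = 0")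
proof -
  have ker: "?A *v x = 0 \<longleftrightarrow>
      x $ 1 + a * x $ 3 + x $ 4 = 0 \<and> x $ 2 + x $ 5 = 0 \<and>
      t * x $ 1 + y * e * x $ 2 - t * x $ 4 - y * e * x $ 5 = 0 \<and>
      - (y * e * x $ 1) + t * x $ 2 + 2/3 * y * a * x $ 3 + y * e * x $ 4 - t * x $ 5 = 0 \<and>
      - (a * t / 2 * x $ 1) - a * y * (c + 1/3) * x $ 2 - a * t / 2 * x $ 4
        - a * y * (c - 1/3) * x $ 5 = 0" for x :: "complex^5"
    by (simp add: vec_eq_iff forall_5 matrix_vector_mult_def sum_5)
  show ?thesis
  proof
    assume "det ?A = 0"
    then obtain x where "x \<noteq> 0" "?A *v x = 0"
      by (auto simp: det_eq_0_iff_ker)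
    note eqs = this(2)[unfolded ker]
    have x5: "x $ 5 = - x $ 2" and x3: "a * x $ 3 = - (x $ 1 + x $ 4)"
      using eqs by algebra+
    have 1: "t * (x $ 1 - x $ 4) = - 2 * (y * e * x $ 2)"
      using eqs x5 by algebra
    have 2: "y * e * (x $ 1 - x $ 4) = 2 * (t * x $ 2) - 2/3 * y * (x $ 1 + x $ 4)"
      using eqs x5 x3 by algebra
    \<comment> \<open>The terms with c cancel because x5 = -x2.\<close>
    have "a * (t * (x $ 1 + x $ 4)) = a * (- 4/3 * (y * x $ 2))"
      using eqs x5 by algebra
    then have 3: "t * (x $ 1 + x $ 4) = - 4/3 * (y * x $ 2)"
      using \<open>a \<noteq> 0\<close> mult_left_cancel by blast
    have "?D * x $ 2 = 0"
      using 1 2 3 by algebra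
    moreover have "x $ 2 \<noteq> 0"
    proof
      assume "x $ 2 = 0"
      with 1 3 \<open>t \<noteq> 0\<close> have "x $ 1 - x $ 4 = 0" "x $ 1 + x $ 4 = 0"
        by auto
      then have "x $ 1 = 0" "x $ 4 = 0"
        by algebra+
      with x3 x5 \<open>x $ 2 = 0\<close> \<open>a \<noteq> 0\<close> \<open>x \<noteq> 0\<close> show False
        by (simp add: vec_eq_iff forall_5)
    qed
    ultimately show "?D = 0"
      by simp
  next
    assume D: "?D = 0"
    \<comment> \<open>Back substitution with x2 = t, which clears the denominators t.\<close>
    define x :: "complex^5" where "x = vector [- y * e - 2/3 * y, t, 4/3 * y / a, y * e - 2/3 * y, - t]"
    have x: "x $ 1 = - y * e - 2/3 * y" "x $ 2 = t" "a * x $ 3 = 4/3 * y" "x $ 4 = y * e - 2/3 * y"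
      "x $ 5 = - t"
      using \<open>a \<noteq> 0\<close> by (simp_all add: x_def)
    have "?A *v x = 0"
      unfolding ker using D x by (intro conjI; algebra)
    moreover have "x \<noteq> 0"
      using x(2) \<open>t \<noteq> 0\<close> by auto
    ultimately show "det ?A = 0"
      by (auto simp: det_eq_0_iff_ker)
  qed
qed

section \<open>Stress and elasticity of the Hadamard material\<close>

text \<open>The gradient of \<open>det\<close>. In dimension two it is linear in F, hence its own
  derivative.\<close>

definition cofactor_2 :: "real^2^2 \<Rightarrow> real^2^2" where
  "cofactor_2 F = vector [vector [F $ 2 $ 2, - F $ 2 $ 1], vector [- F $ 1 $ 2, F $ 1 $ 1]]"

definition hadamard_h' :: "real \<Rightarrow> real \<Rightarrow> real" where
  "hadamard_h' J0 J = ((J - J0) ^ 3 - (J - J0)) / J0"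

lemma hadamard_energy_has_derivative:
  assumes "J0 > 0"
  shows "(hadamard_energy J0 \<mu> has_derivative (\<lambda>H. \<Sum>k\<in>UNIV. \<Sum>j\<in>UNIV.
    (\<mu> * F $ k $ j + hadamard_h' J0 (det F) * cofactor_2 F $ k $ j) * H $ k $ j)) (at F)"
proof -
  have eq: "hadamard_energy J0 \<mu> = (\<lambda>F. \<mu> / 2 *
      (F $ 1 $ 1 * F $ 1 $ 1 + F $ 1 $ 2 * F $ 1 $ 2 + F $ 2 $ 1 * F $ 2 $ 1 + F $ 2 $ 2 * F $ 2 $ 2)
      + 1 / (4 * J0) * ((J0 - (F $ 1 $ 1 * F $ 2 $ 2 - F $ 1 $ 2 * F $ 2 $ 1))\<^sup>2 - 1)\<^sup>2)"
    by (simp add: fun_eq_iff hadamard_energy_def hadamard_h_def det_2 trace_def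
        matrix_matrix_mult_def transpose_def sum_2 algebra_simps)
  show ?thesis
    unfolding eq
    by ((rule derivative_eq_intros refl)+,
        use assms in \<open>simp add: fun_eq_iff sum_2 cofactor_2_def hadamard_h'_def det_2\<close>)
      (simp add: field_simps power2_eq_square power3_eq_cube)
qed

lemma stress_hadamard_energy:
  assumes "J0 > 0"
  shows "stress (hadamard_energy J0 \<mu>) F = \<mu> *\<^sub>R F + hadamard_h' J0 (det F) *\<^sub>R cofactor_2 F"
  unfolding stress_def frechet_derivative_at[OF hadamard_energy_has_derivative[OF assms], symmetric]
  by (simp add: vec_eq_iff forall_2 sum_2 axis_def)

text \<open>The second hypothesis places det F at an inflection point of h. There h'(det F) has zero
  derivative, so the stress is differentiated as if this factor were constant.\<close>

lemma stress_hadamard_has_derivative: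
  assumes "J0 > 0" and "3 * (det F - J0)\<^sup>2 = 1"
  shows "((\<lambda>H. stress (hadamard_energy J0 \<mu>) H $ k $ j) has_derivative
    (\<lambda>H. (\<mu> *\<^sub>R H + hadamard_h' J0 (det F) *\<^sub>R cofactor_2 H) $ k $ j)) (at F)"
proof -
  have cof: "((\<lambda>H. cofactor_2 H $ k $ j) has_derivative (\<lambda>H. cofactor_2 H $ k $ j)) (at F)"
    using exhaust_2[of k] exhaust_2[of j]
    by (auto simp: cofactor_2_def) (auto intro!: derivative_eq_intros)
  have "(hadamard_h' J0 has_real_derivative (3 * (det F - J0)\<^sup>2 - 1) / J0) (at (det F))"
    unfolding hadamard_h'_def using assms(1) by (auto intro!: derivative_eq_intros)
  then have h: "(hadamard_h' J0 has_derivative (\<lambda>_. 0)) (at (det F))"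
    unfolding has_field_derivative_def
    by (rule has_derivative_eq_rhs) (simp add: assms(2) fun_eq_iff)
  \<comment> \<open>Existence of a derivative of \<open>det\<close> is enough, since it is composed
    with a zero derivative.\<close>
  have "\<exists>D. ((det :: real^2^2 \<Rightarrow> real) has_derivative D) (at F)"
    unfolding det_2[abs_def] by (rule exI derivative_intros)+
  then obtain D where "((det :: real^2^2 \<Rightarrow> real) has_derivative D) (at F)" ..
  from has_derivative_compose[OF this h]
  have "((\<lambda>H::real^2^2. hadamard_h' J0 (det H)) has_derivative (\<lambda>_. 0)) (at F)"
    by simp
  note this[derivative_intros] cof[derivative_intros]
  show ?thesis
    unfolding stress_hadamard_energy[OF assms(1)] vector_add_component vector_scaleR_component
    by (auto intro!: derivative_eq_intros)
qed

lemma skew_elasticity_hadamard_energy: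
  assumes "J0 > 0" "\<mu> > 0" and "3 * (det F - J0)\<^sup>2 = 1"
  shows "skew_elasticity (hadamard_energy J0 \<mu>) F \<mu> (hadamard_h' J0 (det F))"
  using assms(2)
  by unfold_locales
    (simp_all add: elast_def vec_eq_iff forall_2 rot90_def mat_def axis_def cofactor_2_def
      frechet_derivative_at[OF stress_hadamard_has_derivative[OF assms(1,3)], symmetric])

section \<open>Zeros of the determinant for the Hadamard phase boundary\<close>

lemma lopatinskii_hadamard_eq_0_iff:
  assumes J0: "J0 > 0" and \<mu>: "\<mu> > 0" and p: "(lam, \<xi>) \<in> Gamma_plus"
  shows "lopatinskii (hadamard_energy J0 \<mu>) (maxwell_rule (hadamard_energy J0 \<mu>))
      (F_minus J0 \<mu>) (F_plus J0 \<mu>) (lam, \<xi>) = 0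
    \<longleftrightarrow> lam\<^sup>2 = - of_real (\<mu> * delta1 J0 \<mu> * \<xi>\<^sup>2)"
proof -
  define W where "W = hadamard_energy J0 \<mu>"
  \<comment> \<open>The determinants of the phases are J0 \<plusminus> s, h' takes the values -e and
    e there, and \<alpha> is the jump of \<open>F $ 1 $ 1\<close>.\<close>
  define s where "s = 1 / sqrt (3::real)"
  define r where "r = sqrt (theta0 J0 \<mu>)"
  define e where "e = 2 * s / (3 * J0)"
  define \<alpha> where "\<alpha> = 2 * s / r"
  define Fp where "Fp = F_plus J0 \<mu>"
  define Fm where "Fm = F_minus J0 \<mu>"
  have s: "s > 0" "s\<^sup>2 = 1 / 3"
    by (simp_all add: s_def power_divide)
  have r: "r > 0" "r\<^sup>2 = 3 * \<mu> * J0 / 2"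
    using J0 \<mu> by (simp_all add: r_def theta0_def)
  have \<alpha>: "\<alpha> > 0"
    using s r by (simp add: \<alpha>_def)
  have F: "Fp = vector [vector [(J0 + s) / r, 0], vector [0, r]]"
    "Fm = vector [vector [(J0 - s) / r, 0], vector [0, r]]"
    by (simp_all add: Fp_def Fm_def F_plus_def F_minus_def s_def r_def)
  have det: "det Fp = J0 + s" "det Fm = J0 - s"
    using r(1) by (simp_all add: F det_2)
  have h: "hadamard_h' J0 (J0 + s) = - e" "hadamard_h' J0 (J0 - s) = e"
    using s(2) J0 by (simp_all add: hadamard_h'_def e_def power3_eq_cube power2_eq_square field_simps)
  have crit: "3 * (det Fp - J0)\<^sup>2 = 1" "3 * (det Fm - J0)\<^sup>2 = 1"
    using s by (simp_all add: det)
  interpret p: skew_elasticity W Fp \<mu> "- e"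
    using skew_elasticity_hadamard_energy[OF J0 \<mu> crit(1)] by (simp add: W_def det h)
  interpret m: skew_elasticity W Fm \<mu> e
    using skew_elasticity_hadamard_energy[OF J0 \<mu> crit(2)] by (simp add: W_def det h)
  have stress: "stress W Fp = vector [vector [\<mu> * (J0 + s) / r - e * r, 0],
        vector [0, \<mu> * r - e * (J0 + s) / r]]"
    "stress W Fm = vector [vector [\<mu> * (J0 - s) / r + e * r, 0],
        vector [0, \<mu> * r + e * (J0 - s) / r]]"
    by (simp_all add: W_def stress_hadamard_energy[OF J0] det h)
      (simp_all add: F cofactor_2_def vec_eq_iff forall_2)
  \<comment> \<open>The value of \<open>theta0\<close> gives e r^2 = \<mu> s, which is exactly
    continuity of the normal stress.\<close>
  have Rankine_Hugoniot: "\<mu> * (J0 + s) / r - e * r = \<mu> * (J0 - s) / r + e * r"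
    using r J0 by (simp add: e_def field_simps power2_eq_square)
  \<comment> \<open>The jump of the first stress column vanishes, and the thirds come from e J0 / r
    = \<alpha> / 3.\<close>
  have grad: "maxwell_gap_gradient W Fm Fp
      = vstack (vector [- (\<alpha> * \<mu> / 2), 0]) (vstack (vector [0, \<mu> * r - \<alpha> / 3]) 0)"
    "maxwell_gap_gradient W Fp Fm
      = vstack (vector [\<alpha> * \<mu> / 2, 0]) (vstack (vector [0, \<mu> * r + \<alpha> / 3]) 0)"
    unfolding maxwell_gap_gradient_def stress p.elast_11 p.elast_21 m.elast_11 m.elast_21
    using r(1) J0
    by (simp_all add: vec_eq_vstack_iff split_sum_all forall_2 sum_2 mat_def rot90_def
        Rankine_Hugoniot F) (simp_all add: \<alpha>_def e_def field_simps)
  have diff: "W differentiable at Fp" "W differentiable at Fm"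
    "(\<lambda>H. stress W H $ k $ 1) differentiable at Fp"
    "(\<lambda>H. stress W H $ k $ 1) differentiable at Fm" for k
    unfolding W_def differentiable_def
    using hadamard_energy_has_derivative[OF J0] stress_hadamard_has_derivative[OF J0 crit(1)]
      stress_hadamard_has_derivative[OF J0 crit(2)] by blast+
  define b where "b = csqrt (lam\<^sup>2 / of_real \<mu> + of_real (\<xi>\<^sup>2))"
  have b: "\<mu> * b\<^sup>2 = lam\<^sup>2 + \<mu> * \<xi>\<^sup>2"
    using \<mu> by (simp add: b_def field_simps)
  have "Re lam > 0"
    using p by (simp add: Gamma_plus_def)
  then have "Re b > 0"
    unfolding b_def using csqrt_Re_pos \<mu> by blast
  note Rm = m.R_stable_eq[OF p b \<open>Re b > 0\<close>]
  note Rp = p.R_unstable_eq[OF p b \<open>Re b > 0\<close>]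
  have pp: "p_plus W (maxwell_rule W) Fm Fp (lam, \<xi>)
      = vector [- (\<alpha> * (\<mu> * b) / 2), - (\<i> * \<xi> * (\<mu> * r - \<alpha> / 3))]"
    unfolding p_plus_def maxwell_rule_axis_1 fst_conv snd_conv
      state_gradient_maxwell_gap(1)[OF diff(1,3)] Rp
    using p.K_matrix_mult[of lam \<xi> b]
    by (simp add: grad vector_matrix_mult_def vec_eq_iff forall_2 sum_UNIV_Plus sum_2 cvec_def mat_def)
  \<comment> \<open>Compared with the plus side, both the sign of b and the sign of the first
    gradient entry flip, so the first entries of \<open>p_minus\<close> and \<open>p_plus\<close>
    agree.\<close>
  have pm: "p_minus W (maxwell_rule W) Fm Fp (lam, \<xi>)
      = vector [- (\<alpha> * (\<mu> * b) / 2), - (\<i> * \<xi> * (\<mu> * r + \<alpha> / 3))]"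
    unfolding p_minus_def maxwell_rule_axis_1 fst_conv snd_conv
      state_gradient_maxwell_gap(2)[OF diff(2,4)] Rm
    using m.K_matrix_mult[of lam \<xi> "- b"]
    by (simp add: grad vector_matrix_mult_def vec_eq_iff forall_2 sum_UNIV_Plus sum_2 cvec_def mat_def)
  have Q: "Q_hat W Fm Fp \<xi> = vstack (vector [of_real \<alpha>, 0]) (vector [0, 2/3 * (\<i> * \<xi>) * \<alpha>])"
    unfolding Q_hat_def stress using r J0
    by (simp add: vec_eq_vstack_iff forall_2 cvec_def column_def F \<alpha>_def e_def)
      (simp add: field_simps)
  have q: "q_hat (maxwell_rule W) Fm Fp lam \<xi> = 0"
    by (rule q_hat_maxwell_eq_0) (simp add: sum_2 stress, simp add: F)
  define t y c where "t = of_real \<mu> * b" and "y = \<i> * of_real \<xi>" and "c = complex_of_real (\<mu> * r / \<alpha>)"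
  have row: "\<i> * \<xi> * (\<mu> * r - \<alpha> / 3) = of_real \<alpha> * y * (c - 1/3)"
    "\<i> * \<xi> * (\<mu> * r + \<alpha> / 3) = of_real \<alpha> * y * (c + 1/3)"
    using \<alpha> by (simp_all add: y_def c_def field_simps)
  have "lopatinskii W (maxwell_rule W) Fm Fp (lam, \<xi>) = det (vector
       [vector [1, 0, of_real \<alpha>, 1, 0],
        vector [0, 1, 0, 0, 1],
        vector [t, y * of_real e, 0, - t, - (y * of_real e)],
        vector [- (y * of_real e), t, 2/3 * y * of_real \<alpha>, y * of_real e, - t],
        vector [- (of_real \<alpha> * t / 2), - (of_real \<alpha> * y * (c + 1/3)), 0,
          - (of_real \<alpha> * t / 2), - (of_real \<alpha> * y * (c - 1/3))]] :: complex^5^5)"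
    unfolding lopatinskii_def Let_def Rm Rp pp pm fst_conv snd_conv Q q row
    by (simp add: mat_def t_def y_def mult_ac)
  moreover have "t \<noteq> 0"
    using \<open>Re b > 0\<close> \<mu> by (auto simp: t_def)
  ultimately have "lopatinskii W (maxwell_rule W) Fm Fp (lam, \<xi>) = 0
      \<longleftrightarrow> t\<^sup>2 + y\<^sup>2 * ((of_real e)\<^sup>2 + 4/9) = 0"
    using det_lopatinskii_array[of t "of_real \<alpha>" y "of_real e" c] \<alpha> by simp
  \<comment> \<open>Here t^2 = \<mu> (lam^2 + \<mu> \<xi>^2) and y^2 = -\<xi>^2, while
    \<open>delta1\<close> is 1 - (e^2 + 4/9) / \<mu>^2.\<close>
  also have "t\<^sup>2 + y\<^sup>2 * ((of_real e)\<^sup>2 + 4/9) = \<mu> * (lam\<^sup>2 + of_real (\<mu> * delta1 J0 \<mu> * \<xi>\<^sup>2))"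
  proof -
    have e_sq: "e\<^sup>2 = 4 / (27 * J0\<^sup>2)"
      by (simp add: e_def power_mult_distrib power_divide s(2))
    have \<delta>: "\<mu>\<^sup>2 * delta1 J0 \<mu> = \<mu>\<^sup>2 - (4 / (27 * J0\<^sup>2) + 4/9)"
      using \<mu> J0 by (simp add: delta1_def right_diff_distrib)
    have e2: "\<mu>\<^sup>2 * \<xi>\<^sup>2 - \<xi>\<^sup>2 * (e\<^sup>2 + 4/9) = \<mu>\<^sup>2 * delta1 J0 \<mu> * \<xi>\<^sup>2"
      unfolding e_sq \<delta> by (simp add: algebra_simps)
    have "t\<^sup>2 + y\<^sup>2 * ((of_real e)\<^sup>2 + 4/9)
        = \<mu> * (\<mu> * b\<^sup>2) - of_real (\<xi>\<^sup>2 * (e\<^sup>2 + 4/9))"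
      by (simp add: t_def y_def power2_eq_square algebra_simps)
    also have "\<dots> = \<mu> * lam\<^sup>2 + of_real (\<mu>\<^sup>2 * \<xi>\<^sup>2 - \<xi>\<^sup>2 * (e\<^sup>2 + 4/9))"
      unfolding b by (simp add: power2_eq_square algebra_simps)
    finally show ?thesis
      unfolding e2 by (simp add: power2_eq_square algebra_simps)
  qed
  finally show ?thesis
    using \<mu> by (simp add: W_def Fm_def Fp_def add_eq_0_iff2)
qed

section \<open>The threshold and the two regimes\<close>

text \<open>By its definition \<open>delta1\<close> equals 1 - (\<open>mu_star\<close> /
  \<mu>)^2.\<close>

lemma delta1_neg_iff:
  assumes "J0 > 0" "\<mu> > 0"
  shows "delta1 J0 \<mu> < 0 \<longleftrightarrow> \<mu> < mu_star J0"
proof -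
  have "mu_star J0 > 0"
    by (simp add: mu_star_def add_pos_nonneg)
  then have "\<mu> < mu_star J0 \<longleftrightarrow> \<mu>\<^sup>2 < (mu_star J0)\<^sup>2"
    using assms by (auto intro: power_strict_mono power2_less_imp_less)
  also have "(mu_star J0)\<^sup>2 = 4 / 9 * (1 + 1 / (3 * J0\<^sup>2))"
    by (simp add: mu_star_def power_mult_distrib power_divide)
  also have "\<mu>\<^sup>2 < \<dots> \<longleftrightarrow> 1 - 4 / 9 * (1 + 1 / (3 * J0\<^sup>2)) / \<mu>\<^sup>2 < 0"
    using assms by (simp add: less_divide_eq mult.commute)
  also have "1 - 4 / 9 * (1 + 1 / (3 * J0\<^sup>2)) / \<mu>\<^sup>2 = delta1 J0 \<mu>"
    using assms by (simp add: delta1_def field_simps)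
  finally show ?thesis ..
qed

theorem theorem6p4:
  fixes J0 \<mu> :: real
  assumes "J0 > 1" and "\<mu> > 0"
  shows "(\<mu> < mu_star J0 \<longrightarrow>
            delta1 J0 \<mu> < 0 \<and>
            strongly_unstable (hadamard_energy J0 \<mu>) (maxwell_rule (hadamard_energy J0 \<mu>))
              (F_minus J0 \<mu>) (F_plus J0 \<mu>)) \<and>
         (mu_star J0 \<le> \<mu> \<longrightarrow>
            delta1 J0 \<mu> \<ge> 0 \<and>
            weakly_stable (hadamard_energy J0 \<mu>) (maxwell_rule (hadamard_energy J0 \<mu>))
              (F_minus J0 \<mu>) (F_plus J0 \<mu>))"
proof -
  have "J0 > 0"
    using assms by simp
  note zero_iff = lopatinskii_hadamard_eq_0_iff[OF this \<open>\<mu> > 0\<close>]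
  note delta = delta1_neg_iff[OF \<open>J0 > 0\<close> \<open>\<mu> > 0\<close>]
  let ?d = "\<mu> * delta1 J0 \<mu>"
  have "\<exists>p\<in>Gamma_plus. lopatinskii (hadamard_energy J0 \<mu>) (maxwell_rule (hadamard_energy J0 \<mu>))
      (F_minus J0 \<mu>) (F_plus J0 \<mu>) p = 0" if "delta1 J0 \<mu> < 0"
  proof -
    have d: "?d < 0"
      using that \<open>\<mu> > 0\<close> by (simp add: mult_less_0_iff)
    \<comment> \<open>A real positive root l of l^2 = -d \<xi>^2, with d = \<mu>
      \<open>delta1\<close>; the normalization l^2 + \<xi>^2 = 1 forces \<xi>^2 = 1 / (1 -
      d).\<close>
    define \<xi> l where "\<xi> = 1 / sqrt (1 - ?d)" and "l = sqrt (- ?d) * \<xi>"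
    have "\<xi> > 0" and \<xi>: "\<xi>\<^sup>2 = 1 / (1 - ?d)" and l: "l\<^sup>2 = - ?d * \<xi>\<^sup>2"
      using d by (simp_all add: \<xi>_def l_def power_divide power_mult_distrib)
    have "l\<^sup>2 + \<xi>\<^sup>2 = 1"
      using d \<xi> l by (simp add: field_simps)
    moreover have "l > 0"
      using \<open>\<xi> > 0\<close> d by (simp add: l_def)
    ultimately have "(of_real l, \<xi>) \<in> Gamma_plus"
      by (simp add: Gamma_plus_def Gamma_def)
    moreover have "(of_real l)\<^sup>2 = - complex_of_real (?d * \<xi>\<^sup>2)"
      using l by (metis minus_mult_left of_real_minus of_real_power)
    ultimately show ?thesis
      using zero_iff by blast
  qed
  moreover have "\<forall>p\<in>Gamma_plus. lopatinskii (hadamard_energy J0 \<mu>) (maxwell_rule (hadamard_energy J0 \<mu>))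
      (F_minus J0 \<mu>) (F_plus J0 \<mu>) p \<noteq> 0" if "delta1 J0 \<mu> \<ge> 0"
  proof (clarify)
    fix lam \<xi>
    assume p: "(lam, \<xi>) \<in> Gamma_plus" and "lopatinskii (hadamard_energy J0 \<mu>)
      (maxwell_rule (hadamard_energy J0 \<mu>)) (F_minus J0 \<mu>) (F_plus J0 \<mu>) (lam, \<xi>) = 0"
    then have lam: "lam\<^sup>2 = of_real (- (?d * \<xi>\<^sup>2))"
      using zero_iff by simp
    have "Re lam > 0"
      using p by (simp add: Gamma_plus_def)
    \<comment> \<open>A number whose square is real and nonpositive is purely imaginary.\<close>
    have "Im (lam\<^sup>2) = 0" "Re (lam\<^sup>2) \<le> 0"
      unfolding lam using that \<open>\<mu> > 0\<close> by simp_all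
    with \<open>Re lam > 0\<close> show False
      by (auto simp: power2_eq_square mult_le_0_iff)
  qed
  ultimately show ?thesis
    using delta by (auto simp: strongly_unstable_def weakly_stable_def not_less)
qed

end
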